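(* Let $B_W$ be a $W$-Brownian motion (in law) on $[0,1]$. Suppose that the set of discontinuity points of $W$ in $[0,1)$ is finite, say $0\le d_1<d_2<\dots<d_N$ for some $N\in\mathbb{N}$, let $I_1=[0,d_1)$, $I_2=[d_1,d_2)$, $\ldots$, $I_N=[d_{N-1},d_N)$, $I_{N+1}=[d_N,1)$, and suppose that for each $k$ there exists $\gamma_k\in(0,1]$ such that the restriction of $W$ to $I_k$ is $\gamma_k$-Hölder continuous. Then $B_W$ has a modification whose sample paths are continuous on each interval $I_k$, $k=1,\ldots,N+1$.
   Context: $W:\mathbb{R}\to\mathbb{R}$ is strictly increasing and càdlàg (right-continuous with left limits), with $W(x+1)-W(x)=W(1)-W(0)$ for all $x$, continuous at $0$ and $W(0)=0$. The $W$-Brownian bridge $B_{W,0}=(B_{W,0}(t))_{t\in[0,1]}$ is the centered Gaussian process with covariance $\varrho_{W,0}(t,s)=W(t\wedge s)-\frac{W(t)W(s)}{W(1)}$. A $W$-Brownian motion (in law) on $[0,1]$ is the process $B_W(t)=B_{W,0}(t)+\frac{W(t)}{W(1)}B_1$, where $B_{W,0}$ is a $W$-Brownian bridge and $B_1\sim N(0,W(1))$ is independent of $\sigma(B_{W,0}(t):t\in[0,1])$; equivalently, $B_W$ is a centered Gaussian process with covariance $W(t\wedge s)$. *)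

theory Defs
  imports "HOL-Probability.Probability"
begin

definition cadlag :: "(real \<Rightarrow> real) \<Rightarrow> bool" where
  "cadlag f \<longleftrightarrow> (\<forall>x. continuous (at_right x) f \<and> (\<exists>l. (f \<longlongrightarrow> l) (at_left x)))"

definition hoelder_on :: "real \<Rightarrow> real set \<Rightarrow> (real \<Rightarrow> real) \<Rightarrow> bool" where
  "hoelder_on \<gamma> S f \<longleftrightarrow> (\<exists>C\<ge>0. \<forall>x\<in>S. \<forall>y\<in>S. \<bar>f x - f y\<bar> \<le> C * \<bar>x - y\<bar> powr \<gamma>)"

(* Normal laws with variance 0 are point masses; they must be admitted, since for instance
   a W-Brownian motion vanishes almost surely at time 0. *)
definition normal_rv :: "'a measure \<Rightarrow> ('a \<Rightarrow> real) \<Rightarrow> bool" where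
  "normal_rv M X \<longleftrightarrow> X \<in> borel_measurable M \<and>
     ((\<exists>\<mu> \<sigma>. 0 < \<sigma> \<and> distributed M lborel X (normal_density \<mu> \<sigma>)) \<or>
      (\<exists>c. AE \<omega> in M. X \<omega> = c))"

definition gaussian_process :: "'a measure \<Rightarrow> real set \<Rightarrow> (real \<Rightarrow> 'a \<Rightarrow> real) \<Rightarrow> bool" where
  "gaussian_process M T X \<longleftrightarrow>
     (\<forall>S c. finite S \<longrightarrow> S \<subseteq> T \<longrightarrow> normal_rv M (\<lambda>\<omega>. \<Sum>t\<in>S. c t * X t \<omega>))"

(* The covariance of centered variables is the expectation of their product. *)
definition centered_gaussian_process ::
    "'a measure \<Rightarrow> real set \<Rightarrow> (real \<Rightarrow> 'a \<Rightarrow> real) \<Rightarrow> (real \<Rightarrow> real \<Rightarrow> real) \<Rightarrow> bool" where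
  "centered_gaussian_process M T X \<rho> \<longleftrightarrow> gaussian_process M T X \<and>
     (\<forall>t\<in>T. (\<integral>\<omega>. X t \<omega> \<partial>M) = 0) \<and>
     (\<forall>s\<in>T. \<forall>t\<in>T. (\<integral>\<omega>. X s \<omega> * X t \<omega> \<partial>M) = \<rho> s t)"

definition W_brownian_bridge :: "'a measure \<Rightarrow> (real \<Rightarrow> real) \<Rightarrow> (real \<Rightarrow> 'a \<Rightarrow> real) \<Rightarrow> bool" where
  "W_brownian_bridge M W Z \<longleftrightarrow>
     centered_gaussian_process M {0..1} Z (\<lambda>t s. W (min t s) - W t * W s / W 1)"

(* A condition on the law only; every process built from a W-Brownian bridge and an independent
   normal variable satisfies it, see W_brownian_motion_of_bridge below. *)
definition W_brownian_motion :: "'a measure \<Rightarrow> (real \<Rightarrow> real) \<Rightarrow> (real \<Rightarrow> 'a \<Rightarrow> real) \<Rightarrow> bool" where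
  "W_brownian_motion M W B \<longleftrightarrow>
     centered_gaussian_process M {0..1} B (\<lambda>t s. W (min t s))"

definition modification ::
    "'a measure \<Rightarrow> real set \<Rightarrow> (real \<Rightarrow> 'a \<Rightarrow> real) \<Rightarrow> (real \<Rightarrow> 'a \<Rightarrow> real) \<Rightarrow> bool" where
  "modification M T X Y \<longleftrightarrow>
     (\<forall>t\<in>T. Y t \<in> borel_measurable M \<and> (AE \<omega> in M. Y t \<omega> = X t \<omega>))"

(* The half-open intervals [0,d 1), [d 1,d 2), ..., [d N,1), numbered from 1 to N + 1;
   for N = 0 the only one is [0,1). *)
definition piece :: "nat \<Rightarrow> (nat \<Rightarrow> real) \<Rightarrow> nat \<Rightarrow> real set" where
  "piece N d k = {(if k = 1 then 0 else d (k - 1)) ..< (if k = N + 1 then 1 else d k)}"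

lemma gaussian_process_normal_rv:
  assumes "gaussian_process M T X" "t \<in> T"
  shows "normal_rv M (X t)"
proof -
  have "normal_rv M (\<lambda>\<omega>. \<Sum>u\<in>{t}. 1 * X u \<omega>)"
    using assms unfolding gaussian_process_def by (intro assms(1)[unfolded gaussian_process_def, rule_format]) auto
  then show ?thesis by simp
qed

context prob_space
begin

lemma normal_rv_square_integrable:
  assumes "normal_rv M X"
  shows "integrable M (\<lambda>\<omega>. (X \<omega>)\<^sup>2)"
proof -
  have X: "X \<in> borel_measurable M" using assms by (auto simp: normal_rv_def)
  consider (nondeg) \<mu> \<sigma> where "0 < \<sigma>" "distributed M lborel X (normal_density \<mu> \<sigma>)"
    | (deg) c where "AE \<omega> in M. X \<omega> = c"
    using assms unfolding normal_rv_def by blast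
  then show ?thesis
  proof cases
    case nondeg
    have "integrable lborel (\<lambda>x. normal_density \<mu> \<sigma> x * (x - \<mu>)\<^sup>2)"
      "integrable lborel (\<lambda>x. normal_density \<mu> \<sigma> x * x)"
      "integrable lborel (normal_density \<mu> \<sigma>)"
      using integrable_normal_moment[OF nondeg(1), of \<mu> 2]
        integrable_normal_moment_nz_1[OF nondeg(1), of \<mu>]
        integrable_normal_density[OF nondeg(1)] by auto
    then have "integrable lborel (\<lambda>x. normal_density \<mu> \<sigma> x * (x - \<mu>)\<^sup>2
        + 2 * \<mu> * (normal_density \<mu> \<sigma> x * x) - \<mu>\<^sup>2 * normal_density \<mu> \<sigma> x)"
      by auto
    also have "(\<lambda>x. normal_density \<mu> \<sigma> x * (x - \<mu>)\<^sup>2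
        + 2 * \<mu> * (normal_density \<mu> \<sigma> x * x) - \<mu>\<^sup>2 * normal_density \<mu> \<sigma> x)
      = (\<lambda>x. normal_density \<mu> \<sigma> x * x\<^sup>2)"
      by (auto simp: algebra_simps power2_eq_square)
    finally show ?thesis
      using distributed_integrable[OF nondeg(2), of "\<lambda>x. x\<^sup>2"] by simp
  next
    case deg
    have "integrable M (\<lambda>\<omega>. c\<^sup>2)" by simp
    then show ?thesis
      by (rule integrable_cong_AE_imp) (use deg X in auto)
  qed
qed

lemma normal_rv_integrable:
  assumes "normal_rv M X"
  shows "integrable M X"
  using assms normal_rv_square_integrable[OF assms] square_integrable_imp_integrable
  by (auto simp: normal_rv_def)

lemma normal_rv_add_indep:
  assumes X: "normal_rv M X" and Y: "normal_rv M Y" and ind: "indep_var borel X borel Y"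
  shows "normal_rv M (\<lambda>\<omega>. X \<omega> + Y \<omega>)"
proof -
  have shift: "normal_rv M (\<lambda>\<omega>. U \<omega> + V \<omega>)"
    if U: "normal_rv M U" and V: "V \<in> borel_measurable M" "AE \<omega> in M. V \<omega> = c" for U V c
  proof -
    have mU: "U \<in> borel_measurable M" using U by (auto simp: normal_rv_def)
    consider (nondeg) \<mu> \<sigma> where "0 < \<sigma>" "distributed M lborel U (normal_density \<mu> \<sigma>)"
      | (deg) a where "AE \<omega> in M. U \<omega> = a"
      using U unfolding normal_rv_def by blast
    then show ?thesis
    proof cases
      case nondeg
      have "distributed M lborel (\<lambda>\<omega>. c + 1 * U \<omega>) (normal_density (c + 1 * \<mu>) (\<bar>1\<bar> * \<sigma>))"
        by (rule normal_density_affine[OF nondeg(2,1)]) simp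
      moreover have "distr M lborel (\<lambda>\<omega>. U \<omega> + V \<omega>) = distr M lborel (\<lambda>\<omega>. c + 1 * U \<omega>)"
        using V mU by (intro distr_cong_AE) auto
      ultimately have "distributed M lborel (\<lambda>\<omega>. U \<omega> + V \<omega>) (normal_density (c + \<mu>) \<sigma>)"
        using V mU by (auto simp: distributed_def)
      then show ?thesis using V mU nondeg(1) unfolding normal_rv_def by auto
    next
      case deg
      have "AE \<omega> in M. U \<omega> + V \<omega> = a + c" using deg V(2) by eventually_elim simp
      then show ?thesis using V mU unfolding normal_rv_def by auto
    qed
  qed
  have m: "X \<in> borel_measurable M" "Y \<in> borel_measurable M"
    using X Y by (auto simp: normal_rv_def)
  consider (degX) c where "AE \<omega> in M. X \<omega> = c" | (degY) c where "AE \<omega> in M. Y \<omega> = c"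
    | (nondeg) \<mu> \<sigma> \<nu> \<tau> where "0 < \<sigma>" "distributed M lborel X (normal_density \<mu> \<sigma>)"
        "0 < \<tau>" "distributed M lborel Y (normal_density \<nu> \<tau>)"
    using X Y unfolding normal_rv_def by blast
  then show ?thesis
  proof cases
    case degX
    then show ?thesis using shift[OF Y m(1)] by (simp add: add.commute)
  next
    case degY
    then show ?thesis using shift[OF X m(2)] by simp
  next
    case nondeg
    have "distributed M lborel (\<lambda>x. X x + Y x) (normal_density (\<mu> + \<nu>) (sqrt (\<sigma>\<^sup>2 + \<tau>\<^sup>2)))"
      by (rule add_indep_normal[OF ind nondeg(1,3,2,4)])
    moreover have "0 < sqrt (\<sigma>\<^sup>2 + \<tau>\<^sup>2)" using nondeg by (simp add: add_pos_pos)
    ultimately show ?thesis unfolding normal_rv_def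
      by (intro conjI disjI1 exI[of _ "\<mu> + \<nu>"] exI[of _ "sqrt (\<sigma>\<^sup>2 + \<tau>\<^sup>2)"]
          borel_measurable_add m)
  qed
qed

lemma normal_rv_scale:
  assumes "distributed M lborel X (normal_density \<mu> \<sigma>)" "0 < \<sigma>"
  shows "normal_rv M (\<lambda>\<omega>. c * X \<omega>)"
proof (cases "c = 0")
  case True
  then show ?thesis by (auto simp: normal_rv_def)
next
  case False
  have "distributed M lborel (\<lambda>\<omega>. 0 + c * X \<omega>) (normal_density (0 + c * \<mu>) (\<bar>c\<bar> * \<sigma>))"
    by (rule normal_density_affine[OF assms False])
  moreover have "X \<in> borel_measurable M"
    using distributed_measurable[OF assms(1)] by simp
  ultimately show ?thesis
    using False assms(2) unfolding normal_rv_def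
    by (intro conjI disjI1 exI[of _ "c * \<mu>"] exI[of _ "\<bar>c\<bar> * \<sigma>"]) auto
qed

lemma W_brownian_motion_of_bridge:
  assumes W: "strict_mono W" "W 0 = 0"
    and Z: "W_brownian_bridge M W Z"
    and B1: "distributed M lborel B1 (normal_density 0 (sqrt (W 1)))"
    and ind: "indep_set
          (sigma_sets (space M) {Z t -` A \<inter> space M | t A. t \<in> {0..1} \<and> A \<in> sets borel})
          (sigma_sets (space M) {B1 -` A \<inter> space M | A. A \<in> sets borel})"
    and B: "\<And>t. t \<in> {0..1} \<Longrightarrow> B t = (\<lambda>\<omega>. Z t \<omega> + W t / W 1 * B1 \<omega>)"
  shows "W_brownian_motion M W B"
proof -
  have W1: "0 < W 1" using W by (metis strict_monoD zero_less_one)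
  have mB1: "B1 \<in> borel_measurable M" using distributed_measurable[OF B1] by simp
  have gZ: "gaussian_process M {0..1} Z" using Z
    by (simp add: W_brownian_bridge_def centered_gaussian_process_def)
  have nZ: "normal_rv M (Z t)" if "t \<in> {0..1}" for t
    using gaussian_process_normal_rv[OF gZ that] .
  have nB1: "normal_rv M B1" using normal_rv_scale[OF B1, of 1] W1 by simp
  have comb_ind: "indep_var borel (\<lambda>\<omega>. \<Sum>t\<in>S. c t * Z t \<omega>) borel (\<lambda>\<omega>. b * B1 \<omega>)"
    if "finite S" "S \<subseteq> {0..1}" for S c b
  proof -
    let ?G = "{Z t -` A \<inter> space M | t A. t \<in> {0..1} \<and> A \<in> sets borel}"
    let ?H = "{B1 -` A \<inter> space M | A. A \<in> sets borel}"
    let ?X = "\<lambda>\<omega>. \<Sum>t\<in>S. c t * Z t \<omega>" and ?Y = "\<lambda>\<omega>. b * B1 \<omega>"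
    let ?FG = "sigma (space M) ?G" and ?FH = "sigma (space M) ?H"
    have G: "?G \<subseteq> Pow (space M)" and H: "?H \<subseteq> Pow (space M)" by auto
    have Zt: "Z t \<in> borel_measurable ?FG" if "t \<in> {0..1}" for t
      using that G
      by (intro measurableI) (auto simp: space_measure_of_conv sets_measure_of simp del: atLeastAtMost_iff
          intro!: sigma_sets.Basic)
    have X: "?X \<in> borel_measurable ?FG"
      using that by (intro borel_measurable_sum borel_measurable_times Zt) auto
    have "B1 \<in> borel_measurable ?FH"
      using H
      by (intro measurableI) (auto simp: space_measure_of_conv sets_measure_of intro!: sigma_sets.Basic)
    then have Y: "?Y \<in> borel_measurable ?FH" by simp
    have "sigma_sets (space M) {?X -` A \<inter> space M | A. A \<in> sets borel} \<subseteq> sigma_sets (space M) ?G"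
    proof (rule sigma_sets_mono, safe)
      fix A :: "real set" assume "A \<in> sets borel"
      from measurable_sets[OF X this] show "?X -` A \<inter> space M \<in> sigma_sets (space M) ?G"
        using G by (simp add: space_measure_of_conv sets_measure_of)
    qed
    moreover have "sigma_sets (space M) {?Y -` A \<inter> space M | A. A \<in> sets borel} \<subseteq> sigma_sets (space M) ?H"
    proof (rule sigma_sets_mono, safe)
      fix A :: "real set" assume "A \<in> sets borel"
      from measurable_sets[OF Y this] show "?Y -` A \<inter> space M \<in> sigma_sets (space M) ?H"
        using H by (simp add: space_measure_of_conv sets_measure_of)
    qed
    ultimately have "indep_set (sigma_sets (space M) {?X -` A \<inter> space M | A. A \<in> sets borel})
        (sigma_sets (space M) {?Y -` A \<inter> space M | A. A \<in> sets borel})"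
      using ind unfolding indep_set_def
      by (elim indep_sets_mono_sets) (auto split: bool.split)
    moreover have "?X \<in> borel_measurable M"
      using that nZ by (intro borel_measurable_sum borel_measurable_times) (auto simp: normal_rv_def)
    ultimately show ?thesis using mB1 unfolding indep_var_eq by auto
  qed
  have gB: "gaussian_process M {0..1} B"
    unfolding gaussian_process_def
  proof (intro allI impI)
    fix S c assume S: "finite S" "S \<subseteq> {0..1::real}"
    define b where "b = (\<Sum>t\<in>S. c t * (W t / W 1))"
    have "normal_rv M (\<lambda>\<omega>. (\<Sum>t\<in>S. c t * Z t \<omega>) + b * B1 \<omega>)"
      using gZ S W1 by (intro normal_rv_add_indep comb_ind normal_rv_scale[OF B1])
        (auto simp: gaussian_process_def)
    also have "(\<lambda>\<omega>. (\<Sum>t\<in>S. c t * Z t \<omega>) + b * B1 \<omega>) = (\<lambda>\<omega>. \<Sum>t\<in>S. c t * B t \<omega>)"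
    proof
      fix \<omega>
      have "(\<Sum>t\<in>S. c t * B t \<omega>) = (\<Sum>t\<in>S. c t * Z t \<omega> + c t * (W t / W 1) * B1 \<omega>)"
        using S B by (intro sum.cong) (auto simp: subset_iff algebra_simps)
      then show "(\<Sum>t\<in>S. c t * Z t \<omega>) + b * B1 \<omega> = (\<Sum>t\<in>S. c t * B t \<omega>)"
        by (simp add: b_def sum.distrib sum_distrib_right)
    qed
    finally show "normal_rv M (\<lambda>\<omega>. \<Sum>t\<in>S. c t * B t \<omega>)" .
  qed
  have EB1: "expectation B1 = 0"
    using normal_distributed_expectation[OF _ B1] W1 by simp
  have VB1: "expectation (\<lambda>\<omega>. (B1 \<omega>)\<^sup>2) = W 1"
    using normal_distributed_variance[OF _ B1] W1 by (simp add: EB1)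
  have iB1: "integrable M B1" by (rule normal_rv_integrable[OF nB1])
  have iB1': "integrable M (\<lambda>\<omega>. B1 \<omega> * B1 \<omega>)"
    using normal_rv_square_integrable[OF nB1] by (simp add: power2_eq_square)
  have EZ: "expectation (Z t) = 0" if "t \<in> {0..1}" for t
    using Z that by (simp add: W_brownian_bridge_def centered_gaussian_process_def)
  have iZ: "integrable M (Z t)" if "t \<in> {0..1}" for t
    by (rule normal_rv_integrable[OF nZ[OF that]])
  have ZB_ind: "indep_var borel (Z t) borel B1" if "t \<in> {0..1}" for t
    using comb_ind[of "{t}" "\<lambda>_. 1" 1] that by simp
  have iZB1: "integrable M (\<lambda>\<omega>. Z t \<omega> * B1 \<omega>)"
    and EZB1: "expectation (\<lambda>\<omega>. Z t \<omega> * B1 \<omega>) = 0" if "t \<in> {0..1}" for t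
    using indep_var_integrable[OF ZB_ind iZ iB1] indep_var_lebesgue_integral[OF ZB_ind iZ iB1]
      that EB1 by auto
  have iZZ: "integrable M (\<lambda>\<omega>. Z s \<omega> * Z t \<omega>)" if "s \<in> {0..1}" "t \<in> {0..1}" for s t
  proof (rule Bochner_Integration.integrable_bound)
    show "integrable M (\<lambda>\<omega>. (Z s \<omega>)\<^sup>2 + (Z t \<omega>)\<^sup>2)"
      using normal_rv_square_integrable nZ that by auto
    show "(\<lambda>\<omega>. Z s \<omega> * Z t \<omega>) \<in> borel_measurable M"
      using that by (intro borel_measurable_times) (use nZ in \<open>auto simp: normal_rv_def\<close>)
    have "\<bar>x * y\<bar> \<le> x\<^sup>2 + y\<^sup>2" for x y :: real
    proof -
      have "2 * (\<bar>x\<bar> * \<bar>y\<bar>) \<le> x\<^sup>2 + y\<^sup>2"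
        using sum_squares_bound[of "\<bar>x\<bar>" "\<bar>y\<bar>"] by (simp add: mult.assoc)
      moreover have "0 \<le> \<bar>x\<bar> * \<bar>y\<bar>" by simp
      ultimately show ?thesis unfolding abs_mult by linarith
    qed
    then show "AE \<omega> in M. norm (Z s \<omega> * Z t \<omega>) \<le> norm ((Z s \<omega>)\<^sup>2 + (Z t \<omega>)\<^sup>2)"
      by (intro AE_I2) simp
  qed
  have "expectation (B t) = 0" if "t \<in> {0..1}" for t
    using iZ[OF that] iB1 EZ[OF that] EB1 by (simp add: B[OF that])
  moreover have "expectation (\<lambda>\<omega>. B s \<omega> * B t \<omega>) = W (min s t)"
    if st: "s \<in> {0..1}" "t \<in> {0..1}" for s t
  proof -
    have "(\<lambda>\<omega>. B s \<omega> * B t \<omega>) = (\<lambda>\<omega>. Z s \<omega> * Z t \<omega> + W t / W 1 * (Z s \<omega> * B1 \<omega>)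
        + W s / W 1 * (Z t \<omega> * B1 \<omega>) + W s / W 1 * (W t / W 1) * (B1 \<omega> * B1 \<omega>))"
      by (rule ext, simp only: B[OF st(1)] B[OF st(2)]) (simp only: ring_distribs ac_simps)
    then have "expectation (\<lambda>\<omega>. B s \<omega> * B t \<omega>) = expectation (\<lambda>\<omega>. Z s \<omega> * Z t \<omega>)
        + W s / W 1 * (W t / W 1) * expectation (\<lambda>\<omega>. B1 \<omega> * B1 \<omega>)"
      using iZZ[OF st] iZB1[OF st(1)] iZB1[OF st(2)] iB1' EZB1[OF st(1)] EZB1[OF st(2)]
      by simp
    also have "\<dots> = W (min s t)"
      using Z st VB1 W1
      by (simp add: W_brownian_bridge_def centered_gaussian_process_def power2_eq_square)
    finally show ?thesis .
  qed
  ultimately show ?thesis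
    using gB by (simp add: W_brownian_motion_def centered_gaussian_process_def)
qed

end

end

theory Submission
  imports Defs
begin

text \<open>
  The increment \<open>B s - B t\<close> of a W-Brownian motion is a centered normal variable with variance
  \<open>\<bar>W s - W t\<bar>\<close>. On an interval \<open>[a, b)\<close> on which \<open>W\<close> is Hoelder continuous with exponent \<open>\<gamma>\<close>
  its moment of order \<open>2 p\<close> is therefore at most a constant times \<open>\<bar>s - t\<bar> powr (\<gamma> * p)\<close>. Since all
  moments of a normal law are finite, \<open>p\<close> may be chosen so large that \<open>\<gamma> * p > 1\<close>, however small
  \<open>\<gamma>\<close> is, and then the Kolmogorov--Chentsov criterion (\<open>kolmogorov_chentsov\<close>) yields a continuous
  modification on \<open>[a, b)\<close> (\<open>W_brownian_continuous_modification\<close>). The pieces between consecutive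
  discontinuities of \<open>W\<close> are disjoint, so the modifications obtained piece by piece combine
  into a single process (\<open>modification_glue\<close>).

  The criterion rests on dyadic chaining. At level \<open>n\<close> there are fewer than \<open>2 ^ n\<close> pairs of
  adjacent dyadic points, and by Markov's inequality the moment bound makes it so unlikely that
  the increment over one of them exceeds \<open>q ^ n\<close>, for a suitable \<open>q < 1\<close>, that the union over the
  level still has a summable probability. By Borel--Cantelli almost every path has, from some
  level on, only adjacent dyadic increments of size at most \<open>q ^ n\<close>. For such a path the values at
  the dyadic points \<open>dyadic_floor n t\<close>, which approach \<open>t\<close> from below, converge geometrically and uniformly
  in \<open>t\<close>, and the limit is a continuous function of \<open>t\<close> (\<open>dyadic_chaining\<close>). The same
  Borel--Cantelli argument applied to the single increments from \<open>dyadic_floor n t\<close> to \<open>t\<close> shows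
  that for each fixed \<open>t\<close> this limit is almost surely the value of the original process.
\<close>

section \<open>Dyadic chaining\<close>

definition dyadic_index :: "nat \<Rightarrow> real \<Rightarrow> nat" where
  "dyadic_index n t = nat \<lfloor>2 ^ n * t\<rfloor>"

definition dyadic_floor :: "nat \<Rightarrow> real \<Rightarrow> real" where
  "dyadic_floor n t = real (dyadic_index n t) / 2 ^ n"

lemma dyadic_index_bounds:
  assumes "0 \<le> t"
  shows "real (dyadic_index n t) \<le> 2 ^ n * t" "2 ^ n * t < real (dyadic_index n t) + 1"
proof -
  have "0 \<le> \<lfloor>2 ^ n * t\<rfloor>" using assms by simp
  then have "real (dyadic_index n t) = of_int \<lfloor>2 ^ n * t\<rfloor>"
    unfolding dyadic_index_def by simp
  then show "real (dyadic_index n t) \<le> 2 ^ n * t" "2 ^ n * t < real (dyadic_index n t) + 1"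
    by linarith+
qed

lemma dyadic_index_less:
  assumes "t \<in> {0..<1}"
  shows "dyadic_index n t < 2 ^ n"
proof -
  have "real (dyadic_index n t) \<le> 2 ^ n * t" using dyadic_index_bounds assms by auto
  also have "\<dots> < 2 ^ n * 1" using assms by (intro mult_strict_left_mono) auto
  finally have "real (dyadic_index n t) < real (2 ^ n)" by simp
  then show ?thesis by (simp only: of_nat_less_iff)
qed

lemma dyadic_floor_in_unit:
  assumes "t \<in> {0..<1}"
  shows "dyadic_floor n t \<in> {0..<1}"
proof -
  have "real (dyadic_index n t) < real (2 ^ n)"
    using dyadic_index_less[OF assms] by (simp only: of_nat_less_iff)
  then show ?thesis by (simp add: dyadic_floor_def)
qed

lemma dyadic_floor_dist:
  assumes "0 \<le> t"
  shows "\<bar>dyadic_floor n t - t\<bar> \<le> 1 / 2 ^ n"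
proof -
  have "dyadic_floor n t - t = (real (dyadic_index n t) - 2 ^ n * t) / 2 ^ n"
    by (simp add: dyadic_floor_def field_simps)
  then show ?thesis
    using dyadic_index_bounds[OF assms, of n] by (simp add: abs_le_iff divide_right_mono)
qed

lemma dyadic_index_Suc:
  assumes "0 \<le> t"
  shows "dyadic_index (Suc n) t = 2 * dyadic_index n t \<or>
    dyadic_index (Suc n) t = Suc (2 * dyadic_index n t)"
proof -
  have "real (dyadic_index (Suc n) t) < real (2 * dyadic_index n t + 2)"
    "real (2 * dyadic_index n t) < real (dyadic_index (Suc n) t + 1)"
    using dyadic_index_bounds[OF assms, of n] dyadic_index_bounds[OF assms, of "Suc n"] by auto
  then show ?thesis unfolding of_nat_less_iff by linarith
qed

lemma dyadic_index_near:
  assumes "0 \<le> s" "0 \<le> t" "\<bar>s - t\<bar> < 1 / 2 ^ n"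
  shows "dyadic_index n s \<le> Suc (dyadic_index n t)"
proof -
  have "2 ^ n * s < 2 ^ n * t + 1" using assms(3) by (simp add: abs_less_iff field_simps)
  then have "real (dyadic_index n s) < real (dyadic_index n t + 2)"
    using dyadic_index_bounds[OF assms(1), of n] dyadic_index_bounds[OF assms(2), of n] by simp
  then show ?thesis unfolding of_nat_less_iff by linarith
qed

text \<open>
  The path \<open>f\<close> is arbitrary between the dyadic points. Passing from level \<open>n\<close> to level \<open>n + 1\<close> moves
  \<open>dyadic_floor n t\<close> by at most one grid step, which costs \<open>q ^ (n + 1)\<close>, so the distance from
  level \<open>n\<close> to the limit is at most the geometric tail \<open>K * q ^ n\<close> with \<open>K = q / (1 - q)\<close>. Two
  points at distance less than \<open>1 / 2 ^ n\<close> have equal or adjacent dyadic floors at level \<open>n\<close>, so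
  their limits differ by at most \<open>(2 * K + 1) * q ^ n\<close>.
\<close>

lemma dyadic_chaining:
  fixes f :: "real \<Rightarrow> real"
  assumes q: "0 \<le> q" "q < 1"
    and step: "\<And>n k. m \<le> n \<Longrightarrow> Suc k < 2 ^ n \<Longrightarrow> \<bar>f (Suc k / 2 ^ n) - f (k / 2 ^ n)\<bar> \<le> q ^ n"
  shows "t \<in> {0..<1} \<Longrightarrow> convergent (\<lambda>n. f (dyadic_floor n t))"
    and "continuous_on {0..<1} (\<lambda>t. lim (\<lambda>n. f (dyadic_floor n t)))"
proof -
  define K where "K = q / (1 - q)"
  define g where "g t = lim (\<lambda>n. f (dyadic_floor n t))" for t
  have K: "0 \<le> K" "K * (1 - q) = q" using q by (auto simp: K_def)
  have neighbour: "\<bar>f (i / 2 ^ n) - f (j / 2 ^ n)\<bar> \<le> q ^ n"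
    if "m \<le> n" "i < 2 ^ n" "j < 2 ^ n" "i \<le> Suc j" "j \<le> Suc i" for n i j :: nat
  proof -
    have "i = j \<or> i = Suc j \<or> j = Suc i" using that by linarith
    then consider "i = j" | "i = Suc j" | "j = Suc i" by blast
    then show ?thesis
    proof cases
      case 2 then show ?thesis using step[of n j] that by simp
    next
      case 3 then show ?thesis using step[of n i] that by (simp add: abs_minus_commute)
    qed (use q in auto)
  qed
  have refine: "\<bar>f (dyadic_floor (Suc n) t) - f (dyadic_floor n t)\<bar> \<le> q ^ Suc n"
    if t: "t \<in> {0..<1}" and n: "m \<le> n" for n t
  proof -
    have "dyadic_floor n t = real (2 * dyadic_index n t) / 2 ^ Suc n"
      by (simp add: dyadic_floor_def)
    moreover have "2 * dyadic_index n t < 2 ^ Suc n" using dyadic_index_less[OF t, of n] by simp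
    moreover have "dyadic_index (Suc n) t \<le> Suc (2 * dyadic_index n t)"
      "2 * dyadic_index n t \<le> Suc (dyadic_index (Suc n) t)"
      using dyadic_index_Suc[of t n] t by auto
    ultimately show ?thesis
      using neighbour[of "Suc n" "dyadic_index (Suc n) t" "2 * dyadic_index n t"]
        dyadic_index_less[OF t, of "Suc n"] n
      by (simp only: dyadic_floor_def le_SucI)
  qed
  \<comment> \<open>Subtracting \<open>K * q ^ (n + j)\<close> makes the geometric sum telescope in the induction over \<open>j\<close>.\<close>
  have tail: "\<bar>f (dyadic_floor (n + j) t) - f (dyadic_floor n t)\<bar> \<le> K * q ^ n - K * q ^ (n + j)"
    if t: "t \<in> {0..<1}" and n: "m \<le> n" for n j t
  proof (induction j)
    case (Suc j)
    have "q ^ Suc (n + j) = K * (1 - q) * q ^ (n + j)" by (simp add: K(2))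
    also have "\<dots> = K * q ^ (n + j) - K * q ^ Suc (n + j)" by (simp add: algebra_simps)
    finally show ?case using Suc refine[OF t, of "n + j"] n by simp
  qed simp
  have tail': "\<bar>f (dyadic_floor i t) - f (dyadic_floor n t)\<bar> \<le> K * q ^ n"
    if "t \<in> {0..<1}" "m \<le> n" "n \<le> i" for n i t
  proof -
    have "0 \<le> K * q ^ i" using K q by simp
    then show ?thesis using tail[OF that(1,2), of "i - n"] that(3) by simp
  qed
  have small: "\<exists>n\<ge>m. c * q ^ n < e" if "0 < e" for c e :: real
  proof -
    have "(\<lambda>n. c * q ^ n) \<longlonglongrightarrow> c * 0"
      using q by (intro tendsto_mult tendsto_const LIMSEQ_realpow_zero)
    then have "eventually (\<lambda>n. c * q ^ n < e \<and> m \<le> n) sequentially"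
      using that by (intro eventually_conj order_tendstoD(2) eventually_ge_at_top) auto
    then show ?thesis using eventually_happens'[OF sequentially_bot] by blast
  qed
  show conv: "convergent (\<lambda>n. f (dyadic_floor n t))" if t: "t \<in> {0..<1}" for t
  proof (intro Cauchy_convergent metric_CauchyI)
    fix e :: real assume "0 < e"
    then obtain n where n: "m \<le> n" "2 * K * q ^ n < e" using small by blast
    have "dist (f (dyadic_floor i t)) (f (dyadic_floor j t)) < e" if "n \<le> i" "n \<le> j" for i j
      using tail'[OF t n(1) that(1)] tail'[OF t n(1) that(2)] n(2) unfolding dist_real_def by linarith
    then show "\<exists>n. \<forall>i\<ge>n. \<forall>j\<ge>n. dist (f (dyadic_floor i t)) (f (dyadic_floor j t)) < e" by blast
  qed
  have limit: "\<bar>g t - f (dyadic_floor n t)\<bar> \<le> K * q ^ n" if "t \<in> {0..<1}" "m \<le> n" for n t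
  proof (rule LIMSEQ_le_const2)
    show "(\<lambda>i. \<bar>f (dyadic_floor i t) - f (dyadic_floor n t)\<bar>) \<longlonglongrightarrow> \<bar>g t - f (dyadic_floor n t)\<bar>"
      using conv[OF that(1)] by (intro tendsto_intros) (simp add: g_def convergent_LIMSEQ_iff)
    show "\<exists>N. \<forall>i\<ge>N. \<bar>f (dyadic_floor i t) - f (dyadic_floor n t)\<bar> \<le> K * q ^ n"
      using tail' that by blast
  qed
  have "continuous_on {0..<1} g"
  proof (rule uniformly_continuous_imp_continuous, unfold uniformly_continuous_on_def, intro allI impI)
    fix e :: real assume "0 < e"
    then obtain n where n: "m \<le> n" "(2 * K + 1) * q ^ n < e" using small by blast
    have "dist (g s) (g t) < e" if st: "s \<in> {0..<1}" "t \<in> {0..<1}" and near: "\<bar>s - t\<bar> < 1 / 2 ^ n" for s t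
    proof -
      have "\<bar>f (dyadic_floor n s) - f (dyadic_floor n t)\<bar> \<le> q ^ n"
        unfolding dyadic_floor_def using n st near
        by (intro neighbour dyadic_index_less dyadic_index_near) (auto simp: abs_minus_commute)
      then have "\<bar>g s - g t\<bar> \<le> K * q ^ n + q ^ n + K * q ^ n"
        using limit[OF st(1) n(1)] limit[OF st(2) n(1)] by linarith
      also have "\<dots> = (2 * K + 1) * q ^ n" by (simp add: algebra_simps)
      finally show ?thesis using n by (simp add: dist_real_def)
    qed
    then show "\<exists>d>0. \<forall>s\<in>{0..<1}. \<forall>t\<in>{0..<1}. dist t s < d \<longrightarrow> dist (g t) (g s) < e"
      by (intro exI[of _ "1 / 2 ^ n"]) (simp add: dist_real_def)
  qed
  then show "continuous_on {0..<1} (\<lambda>t. lim (\<lambda>n. f (dyadic_floor n t)))" by (simp add: g_def)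
qed


section \<open>The Kolmogorov--Chentsov criterion\<close>

context prob_space
begin

lemma absolute_moment_tail:
  fixes Z :: "'a \<Rightarrow> real"
  assumes "integrable M (\<lambda>\<omega>. \<bar>Z \<omega>\<bar> powr \<alpha>)" and [measurable]: "Z \<in> borel_measurable M"
    and "0 < \<alpha>" "0 < e"
  shows "prob {\<omega>\<in>space M. e < \<bar>Z \<omega>\<bar>} \<le> expectation (\<lambda>\<omega>. \<bar>Z \<omega>\<bar> powr \<alpha>) / e powr \<alpha>"
proof -
  have "prob {\<omega>\<in>space M. e < \<bar>Z \<omega>\<bar>} \<le> prob {\<omega>\<in>space M. e powr \<alpha> \<le> \<bar>Z \<omega>\<bar> powr \<alpha>}"
    using assms(3,4) by (intro finite_measure_mono) (auto intro: powr_mono2)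
  also have "\<dots> \<le> expectation (\<lambda>\<omega>. \<bar>Z \<omega>\<bar> powr \<alpha>) / e powr \<alpha>"
    using assms by (intro integral_Markov_inequality_measure[where A="space M"]) auto
  finally show ?thesis .
qed

text \<open>
  With \<open>r = 2 powr (- \<beta> / 2)\<close> and \<open>q\<close> such that \<open>q powr \<alpha> = r\<close>, an increment over a distance of at
  most \<open>1 / 2 ^ n\<close> exceeds \<open>q ^ n\<close> with probability at most \<open>C * r ^ n / 2 ^ n\<close>: half of the gain
  \<open>2 powr (- \<beta> * n)\<close> pays for the threshold, the other half is left as \<open>r ^ n\<close>, and the factor
  \<open>1 / 2 ^ n\<close> compensates for the number of grid steps at level \<open>n\<close>.
\<close>

lemma kolmogorov_chentsov_unit:
  fixes X :: "real \<Rightarrow> 'a \<Rightarrow> real"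
  assumes X: "\<And>t. t \<in> {0..<1} \<Longrightarrow> X t \<in> borel_measurable M"
    and pos: "0 < \<alpha>" "0 < \<beta>" "0 \<le> C"
    and int: "\<And>s t. s \<in> {0..<1} \<Longrightarrow> t \<in> {0..<1} \<Longrightarrow> integrable M (\<lambda>\<omega>. \<bar>X s \<omega> - X t \<omega>\<bar> powr \<alpha>)"
    and mom: "\<And>s t. s \<in> {0..<1} \<Longrightarrow> t \<in> {0..<1} \<Longrightarrow>
      expectation (\<lambda>\<omega>. \<bar>X s \<omega> - X t \<omega>\<bar> powr \<alpha>) \<le> C * \<bar>s - t\<bar> powr (1 + \<beta>)"
  shows "\<exists>Y. modification M {0..<1} X Y \<and> (\<forall>\<omega>\<in>space M. continuous_on {0..<1} (\<lambda>t. Y t \<omega>))"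
proof -
  define r :: real where "r = 2 powr (- \<beta> / 2)"
  define q :: real where "q = 2 powr (- \<beta> / (2 * \<alpha>))"
  have r: "0 < r" "r < 1" using pos by (auto simp: r_def powr_less_one)
  have q: "0 < q" "q < 1" using pos by (auto simp: q_def powr_less_one)
  have q_powr: "(q ^ n) powr \<alpha> = r ^ n" for n
    using pos by (simp add: q_def r_def powr_powr powr_power)
  have mesh_powr: "(1 / 2 ^ n) powr (1 + \<beta>) = (1 / 2) ^ n * r ^ n * r ^ n" for n :: nat
  proof -
    have half: "(1 / 2 ^ n :: real) = 2 powr (- real n)"
      by (simp add: powr_minus_divide powr_realpow)
    have rn: "r ^ n = 2 powr (- \<beta> / 2 * real n)" by (simp add: r_def powr_power mult.commute)
    have "(1 / 2 ^ n) powr (1 + \<beta>) = 2 powr (- real n * (1 + \<beta>))"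
      by (simp only: half powr_powr)
    also have "- real n * (1 + \<beta>) = - real n + - \<beta> / 2 * real n + - \<beta> / 2 * real n"
      by (simp add: algebra_simps)
    also have "2 powr \<dots> = (1 / 2 ^ n) * r ^ n * r ^ n"
      by (simp only: powr_add half rn)
    also have "\<dots> = (1 / 2) ^ n * r ^ n * r ^ n" by (simp only: power_one_over)
    finally show ?thesis .
  qed
  define jump where "jump n s t = {\<omega>\<in>space M. q ^ n < \<bar>X s \<omega> - X t \<omega>\<bar>}" for n s t
  have jump_sets: "jump n s t \<in> events" if "s \<in> {0..<1}" "t \<in> {0..<1}" for n s t
    using X[OF that(1)] X[OF that(2)] unfolding jump_def by measurable
  have jump_prob: "prob (jump n s t) \<le> C * r ^ n * (1 / 2) ^ n"
    if st: "s \<in> {0..<1}" "t \<in> {0..<1}" and near: "\<bar>s - t\<bar> \<le> 1 / 2 ^ n" for n s t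
  proof -
    have "prob (jump n s t) \<le> expectation (\<lambda>\<omega>. \<bar>X s \<omega> - X t \<omega>\<bar> powr \<alpha>) / (q ^ n) powr \<alpha>"
      unfolding jump_def using st pos q
      by (intro absolute_moment_tail int borel_measurable_diff X) auto
    also have "\<dots> \<le> C * (1 / 2 ^ n) powr (1 + \<beta>) / (q ^ n) powr \<alpha>"
      using near pos by (intro divide_right_mono order_trans[OF mom[OF st]] mult_left_mono powr_mono2) auto
    also have "\<dots> = C * r ^ n * (1 / 2) ^ n"
      using r by (simp add: mesh_powr q_powr)
    finally show ?thesis .
  qed
  have summable_r: "summable (\<lambda>n. C * r ^ n)"
    using r by (intro summable_mult summable_geometric) auto
  have at_points: "AE \<omega> in M. (\<lambda>n. X (dyadic_floor n t) \<omega>) \<longlonglongrightarrow> X t \<omega>" if t: "t \<in> {0..<1}" for t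
  proof -
    let ?A = "\<lambda>n. jump n (dyadic_floor n t) t"
    have "prob (?A n) \<le> C * r ^ n" for n
    proof -
      have "prob (?A n) \<le> C * r ^ n * (1 / 2) ^ n"
        using t by (intro jump_prob dyadic_floor_in_unit dyadic_floor_dist) auto
      also have "\<dots> \<le> C * r ^ n" using pos r by (intro mult_right_le_one_le) (auto simp: power_le_one)
      finally show ?thesis .
    qed
    then have "summable (\<lambda>n. prob (?A n))"
      by (intro summable_comparison_test'[OF summable_r, of 0]) auto
    then have "AE \<omega> in M. eventually (\<lambda>n. \<omega> \<in> space M - ?A n) sequentially"
      using t by (intro borel_cantelli_AE1 jump_sets dyadic_floor_in_unit)
        (auto simp: emeasure_eq_measure)
    then show ?thesis
    proof eventually_elim
      case (elim \<omega>)
      have "eventually (\<lambda>n. dist (X (dyadic_floor n t) \<omega>) (X t \<omega>) \<le> q ^ n) sequentially"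
        using elim by eventually_elim (auto simp: jump_def dist_real_def)
      then have "eventually (\<lambda>n. dist (X (dyadic_floor n t) \<omega>) (X t \<omega>) \<le> dist (q ^ n) 0) sequentially"
        using q by (simp add: dist_real_def)
      moreover have "(\<lambda>n. q ^ n) \<longlonglongrightarrow> 0" using q by (intro LIMSEQ_realpow_zero) auto
      ultimately show ?case by (rule metric_tendsto_imp_tendsto[rotated])
    qed
  qed
  \<comment> \<open>Nothing is known about \<open>X\<close> at time \<open>1\<close>, so the last grid step of each level is left out.\<close>
  define bad where "bad n = (\<Union>k\<in>{k. Suc k < 2 ^ n}. jump n (Suc k / 2 ^ n) (k / 2 ^ n))" for n
  have grid: "k / 2 ^ n \<in> {0..<1::real}" if "k < 2 ^ n" for k n :: nat
    using that by (simp add: of_nat_less_numeral_power_cancel_iff)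
  have fin: "finite {k. Suc k < 2 ^ n}" for n :: nat
    by (rule finite_subset[of _ "{..<2 ^ n}"]) auto
  have step_sets: "jump n (Suc k / 2 ^ n) (k / 2 ^ n) \<in> events" if "Suc k < 2 ^ n" for k n
    using that by (intro jump_sets grid) auto
  have bad_sets: "bad n \<in> events" for n
    unfolding bad_def using fin by (intro sets.finite_UN step_sets) auto
  have "prob (bad n) \<le> C * r ^ n" for n
  proof -
    have "prob (bad n) \<le> (\<Sum>k | Suc k < 2 ^ n. prob (jump n (Suc k / 2 ^ n) (k / 2 ^ n)))"
      unfolding bad_def using fin by (intro finite_measure_subadditive_finite)
        (auto intro!: step_sets simp del: of_nat_Suc)
    also have "\<dots> \<le> (\<Sum>k | Suc k < 2 ^ n. C * r ^ n * (1 / 2) ^ n)"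
      by (intro sum_mono jump_prob grid) (auto simp: diff_divide_distrib[symmetric])
    also have "\<dots> \<le> (\<Sum>k<(2::nat) ^ n. C * r ^ n * (1 / 2) ^ n)"
      using pos r by (intro sum_mono2) auto
    also have "\<dots> = C * r ^ n" by (simp add: power_one_over)
    finally show ?thesis .
  qed
  then have "summable (\<lambda>n. prob (bad n))"
    by (intro summable_comparison_test'[OF summable_r, of 0]) auto
  then have "AE \<omega> in M. eventually (\<lambda>n. \<omega> \<in> space M - bad n) sequentially"
    by (intro borel_cantelli_AE1 bad_sets) (auto simp: emeasure_eq_measure)
  then obtain Z where Z: "Z \<in> null_sets M"
    and good: "\<And>\<omega>. \<omega> \<in> space M - Z \<Longrightarrow> eventually (\<lambda>n. \<omega> \<in> space M - bad n) sequentially"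
    by (rule AE_E3) blast
  have chain: "continuous_on {0..<1} (\<lambda>t. lim (\<lambda>n. X (dyadic_floor n t) \<omega>))"
    if \<omega>: "\<omega> \<in> space M - Z" for \<omega>
  proof -
    obtain m where m: "\<And>n. m \<le> n \<Longrightarrow> \<omega> \<in> space M - bad n"
      using good[OF \<omega>] unfolding eventually_sequentially by blast
    have step: "\<bar>X (Suc k / 2 ^ n) \<omega> - X (k / 2 ^ n) \<omega>\<bar> \<le> q ^ n" if "m \<le> n" "Suc k < 2 ^ n" for n k
    proof -
      have "\<omega> \<notin> jump n (Suc k / 2 ^ n) (k / 2 ^ n)" "\<omega> \<in> space M"
        using m[OF that(1)] that(2) unfolding bad_def by blast+
      then show ?thesis by (simp add: jump_def)
    qed
    show ?thesis
      by (rule dyadic_chaining(2)[OF less_imp_le[OF q(1)] q(2) step])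
  qed
  \<comment> \<open>One null set \<open>Z\<close> serves all \<open>t\<close>; on it the path is set to zero, so that every path is continuous.\<close>
  define Y where "Y t \<omega> = (if \<omega> \<in> Z then 0 else lim (\<lambda>n. X (dyadic_floor n t) \<omega>))" for t \<omega>
  have "Y t \<in> borel_measurable M" if t: "t \<in> {0..<1}" for t
  proof -
    have "X (dyadic_floor n t) \<in> borel_measurable M" for n
      by (rule X[OF dyadic_floor_in_unit[OF t]])
    then show ?thesis unfolding Y_def using Z
      by (intro measurable_If_set borel_measurable_lim_metric) auto
  qed
  moreover have "AE \<omega> in M. Y t \<omega> = X t \<omega>" if t: "t \<in> {0..<1}" for t
    using at_points[OF t] AE_not_in[OF Z] by eventually_elim (simp add: Y_def limI)
  moreover have "continuous_on {0..<1} (\<lambda>t. Y t \<omega>)" if "\<omega> \<in> space M" for \<omega>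
    using chain[of \<omega>] that by (cases "\<omega> \<in> Z") (auto simp: Y_def)
  ultimately show ?thesis unfolding modification_def by blast
qed

text \<open>
  An affine time change carries \<open>[a, b)\<close> to \<open>[0, 1)\<close> and only multiplies the constant by
  \<open>(b - a) powr (1 + \<beta>)\<close>.
\<close>

lemma kolmogorov_chentsov:
  fixes X :: "real \<Rightarrow> 'a \<Rightarrow> real"
  assumes X: "\<And>t. t \<in> {a..<b} \<Longrightarrow> X t \<in> borel_measurable M"
    and pos: "0 < \<alpha>" "0 < \<beta>" "0 \<le> C"
    and int: "\<And>s t. s \<in> {a..<b} \<Longrightarrow> t \<in> {a..<b} \<Longrightarrow> integrable M (\<lambda>\<omega>. \<bar>X s \<omega> - X t \<omega>\<bar> powr \<alpha>)"
    and mom: "\<And>s t. s \<in> {a..<b} \<Longrightarrow> t \<in> {a..<b} \<Longrightarrow>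
      expectation (\<lambda>\<omega>. \<bar>X s \<omega> - X t \<omega>\<bar> powr \<alpha>) \<le> C * \<bar>s - t\<bar> powr (1 + \<beta>)"
  shows "\<exists>Y. modification M {a..<b} X Y \<and> (\<forall>\<omega>\<in>space M. continuous_on {a..<b} (\<lambda>t. Y t \<omega>))"
proof (cases "a < b")
  case False
  then show ?thesis by (intro exI[of _ X]) (auto simp: modification_def)
next
  case ab: True
  define \<phi> where "\<phi> u = a + (b - a) * u" for u
  define \<psi> where "\<psi> t = (t - a) / (b - a)" for t
  have \<phi>: "\<phi> u \<in> {a..<b}" if u: "u \<in> {0..<1}" for u
  proof -
    have "0 \<le> (b - a) * u" using u ab by simp
    moreover have "0 < (b - a) * (1 - u)" using u ab by simp
    moreover have "(b - a) * (1 - u) = b - \<phi> u" by (simp add: \<phi>_def algebra_simps)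
    ultimately show ?thesis by (simp add: \<phi>_def)
  qed
  have \<psi>: "\<psi> t \<in> {0..<1}" if "t \<in> {a..<b}" for t
    using that ab by (auto simp: \<psi>_def)
  have \<phi>\<psi>: "\<phi> (\<psi> t) = t" for t using ab by (simp add: \<phi>_def \<psi>_def)
  have \<phi>_dist: "\<bar>\<phi> u - \<phi> v\<bar> = (b - a) * \<bar>u - v\<bar>" for u v
  proof -
    have "\<phi> u - \<phi> v = (b - a) * (u - v)" by (simp add: \<phi>_def algebra_simps)
    then show ?thesis using ab by (simp add: abs_mult)
  qed
  have "\<exists>Y. modification M {0..<1} (\<lambda>u. X (\<phi> u)) Y \<and> (\<forall>\<omega>\<in>space M. continuous_on {0..<1} (\<lambda>u. Y u \<omega>))"
  proof (rule kolmogorov_chentsov_unit[where \<alpha>=\<alpha> and \<beta>=\<beta> and C="C * (b - a) powr (1 + \<beta>)"])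
    fix u v :: real assume uv: "u \<in> {0..<1}" "v \<in> {0..<1}"
    show "expectation (\<lambda>\<omega>. \<bar>X (\<phi> u) \<omega> - X (\<phi> v) \<omega>\<bar> powr \<alpha>)
        \<le> C * (b - a) powr (1 + \<beta>) * \<bar>u - v\<bar> powr (1 + \<beta>)"
      using mom[OF \<phi>[OF uv(1)] \<phi>[OF uv(2)]] ab by (simp add: \<phi>_dist powr_mult mult.assoc)
  qed (use pos in \<open>auto intro!: X int \<phi> simp del: atLeastLessThan_iff\<close>)
  then obtain Y where Y: "modification M {0..<1} (\<lambda>u. X (\<phi> u)) Y"
    and cont: "\<And>\<omega>. \<omega> \<in> space M \<Longrightarrow> continuous_on {0..<1} (\<lambda>u. Y u \<omega>)" by blast
  have "modification M {a..<b} X (\<lambda>t. Y (\<psi> t))"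
    unfolding modification_def
  proof
    fix t assume "t \<in> {a..<b}"
    from Y[unfolded modification_def, rule_format, OF \<psi>[OF this]]
    show "Y (\<psi> t) \<in> borel_measurable M \<and> (AE \<omega> in M. Y (\<psi> t) \<omega> = X t \<omega>)" by (simp add: \<phi>\<psi>)
  qed
  moreover have "continuous_on {a..<b} (\<lambda>t. Y (\<psi> t) \<omega>)" if "\<omega> \<in> space M" for \<omega>
  proof (rule continuous_on_compose2[OF cont[OF that]])
    show "continuous_on {a..<b} \<psi>" unfolding \<psi>_def using ab by (intro continuous_intros) auto
    show "\<psi> ` {a..<b} \<subseteq> {0..<1}" using \<psi> by (rule image_subsetI)
  qed
  ultimately show ?thesis by (intro exI[of _ "\<lambda>t. Y (\<psi> t)"]) simp
qed

section \<open>Even moments of centered normal variables\<close>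

text \<open>
  The formula is written in terms of the second moment instead of a parameter \<open>\<sigma>\<close>, so that it
  covers the point mass at zero as well; for \<open>p = 0\<close> that case reads \<open>1 = 1\<close>.
\<close>

lemma centered_normal_even_moment:
  assumes X: "normal_rv M X" and zero: "expectation X = 0"
  shows "has_bochner_integral M (\<lambda>\<omega>. X \<omega> ^ (2 * p))
    (fact (2 * p) / (2 ^ p * fact p) * expectation (\<lambda>\<omega>. (X \<omega>)\<^sup>2) ^ p)"
proof -
  have m: "X \<in> borel_measurable M" using X by (simp add: normal_rv_def)
  consider (nondeg) \<mu> \<sigma> where "0 < \<sigma>" "distributed M lborel X (normal_density \<mu> \<sigma>)"
    | (deg) c where "AE \<omega> in M. X \<omega> = c"
    using X unfolding normal_rv_def by blast
  then show ?thesis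
  proof cases
    case nondeg
    have \<mu>: "\<mu> = 0" using normal_distributed_expectation[OF nondeg] zero by simp
    have var: "expectation (\<lambda>\<omega>. (X \<omega>)\<^sup>2) = \<sigma>\<^sup>2"
      using normal_distributed_variance[OF nondeg] zero by simp
    have mom: "has_bochner_integral lborel (\<lambda>x. normal_density \<mu> \<sigma> x * x ^ (2 * p))
        (fact (2 * p) / ((2 / \<sigma>\<^sup>2) ^ p * fact p))"
      using normal_moment_even[OF nondeg(1), of \<mu> p] by (simp add: \<mu>)
    have "integrable M (\<lambda>\<omega>. X \<omega> ^ (2 * p))"
      using distributed_integrable[OF nondeg(2), of "\<lambda>x. x ^ (2 * p)"] mom
      by (simp add: has_bochner_integral_iff)
    moreover have "expectation (\<lambda>\<omega>. X \<omega> ^ (2 * p)) = fact (2 * p) / ((2 / \<sigma>\<^sup>2) ^ p * fact p)"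
      using distributed_integral[OF nondeg(2), of "\<lambda>x. x ^ (2 * p)"] mom
      by (simp add: has_bochner_integral_iff)
    ultimately show ?thesis using nondeg(1)
      by (simp add: has_bochner_integral_iff var power_divide field_simps)
  next
    case deg
    have "expectation X = expectation (\<lambda>\<omega>. c)" using deg m by (intro integral_cong_AE) auto
    then have "c = 0" using zero by (simp add: prob_space)
    then have X0: "AE \<omega> in M. X \<omega> = 0" using deg by simp
    then have "expectation (\<lambda>\<omega>. (X \<omega>)\<^sup>2) = expectation (\<lambda>\<omega>. 0)"
      using m by (intro integral_cong_AE) auto
    moreover have "has_bochner_integral M (\<lambda>\<omega>. X \<omega> ^ (2 * p)) (0 ^ p)"
    proof (subst has_bochner_integral_cong_AE[where g = "\<lambda>\<omega>. 0 ^ p"])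
      show "AE \<omega> in M. X \<omega> ^ (2 * p) = 0 ^ p" using X0 by eventually_elim (simp add: power_mult)
      show "has_bochner_integral M (\<lambda>\<omega>. 0 ^ p) (0 ^ p :: real)"
        by (simp add: has_bochner_integral_iff prob_space)
    qed (use m in auto)
    ultimately show ?thesis by (cases p) auto
  qed
qed

section \<open>Increments of a W-Brownian motion\<close>

lemma W_brownian_measurable:
  assumes "W_brownian_motion M W B" "t \<in> {0..1}"
  shows "B t \<in> borel_measurable M"
proof -
  have "gaussian_process M {0..1} B"
    using assms(1) by (simp add: W_brownian_motion_def centered_gaussian_process_def)
  from gaussian_process_normal_rv[OF this assms(2)] show ?thesis by (simp add: normal_rv_def)
qed

text \<open>
  The covariance gives the variance \<open>W s + W t - 2 * W (min s t)\<close>, and by monotonicity of \<open>W\<close> this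
  is \<open>\<bar>W s - W t\<bar>\<close>.
\<close>

lemma W_brownian_increment:
  assumes B: "W_brownian_motion M W B" and W: "mono W"
    and st: "s \<in> {0..1}" "t \<in> {0..1}"
  shows "normal_rv M (\<lambda>\<omega>. B s \<omega> - B t \<omega>)"
    and "expectation (\<lambda>\<omega>. B s \<omega> - B t \<omega>) = 0"
    and "expectation (\<lambda>\<omega>. (B s \<omega> - B t \<omega>)\<^sup>2) = \<bar>W s - W t\<bar>"
proof -
  have gauss: "gaussian_process M {0..1} B"
    and mean: "\<And>u. u \<in> {0..1} \<Longrightarrow> expectation (B u) = 0"
    and cov: "\<And>u v. u \<in> {0..1} \<Longrightarrow> v \<in> {0..1} \<Longrightarrow> expectation (\<lambda>\<omega>. B u \<omega> * B v \<omega>) = W (min u v)"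
    using B by (auto simp: W_brownian_motion_def centered_gaussian_process_def)
  have normal: "normal_rv M (B u)" if "u \<in> {0..1}" for u
    by (rule gaussian_process_normal_rv[OF gauss that])
  show diff: "normal_rv M (\<lambda>\<omega>. B s \<omega> - B t \<omega>)"
  proof (cases "s = t")
    case True
    then show ?thesis by (auto simp: normal_rv_def)
  next
    case False
    have "normal_rv M (\<lambda>\<omega>. \<Sum>u\<in>{s, t}. (if u = s then 1 else - 1) * B u \<omega>)"
      using gauss[unfolded gaussian_process_def, rule_format, of "{s, t}" "\<lambda>u. if u = s then 1 else - 1"] st
      by simp
    then show ?thesis using False by simp
  qed
  show "expectation (\<lambda>\<omega>. B s \<omega> - B t \<omega>) = 0"
    using st mean normal_rv_integrable[OF normal] by simp
  have sq: "integrable M (\<lambda>\<omega>. (B u \<omega>)\<^sup>2)" "expectation (\<lambda>\<omega>. (B u \<omega>)\<^sup>2) = W u" if "u \<in> {0..1}" for u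
    using normal_rv_square_integrable[OF normal[OF that]] cov[OF that that]
    by (auto simp: power2_eq_square)
  have "expectation (\<lambda>\<omega>. B s \<omega> * B t \<omega>)
      = expectation (\<lambda>\<omega>. ((B s \<omega>)\<^sup>2 + (B t \<omega>)\<^sup>2 - (B s \<omega> - B t \<omega>)\<^sup>2) / 2)"
    by (intro Bochner_Integration.integral_cong) (simp_all add: power2_eq_square algebra_simps)
  also have "\<dots> = (W s + W t - expectation (\<lambda>\<omega>. (B s \<omega> - B t \<omega>)\<^sup>2)) / 2"
    using sq[OF st(1)] sq[OF st(2)] normal_rv_square_integrable[OF diff] by simp
  finally have "expectation (\<lambda>\<omega>. (B s \<omega> - B t \<omega>)\<^sup>2) = W s + W t - 2 * W (min s t)"
    using cov[OF st] by simp
  moreover have "W s + W t - 2 * W (min s t) = \<bar>W s - W t\<bar>"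
  proof (cases "s \<le> t")
    case True
    then show ?thesis using monoD[OF W True] by simp
  next
    case False
    then show ?thesis using monoD[OF W, of t s] by simp
  qed
  ultimately show "expectation (\<lambda>\<omega>. (B s \<omega> - B t \<omega>)\<^sup>2) = \<bar>W s - W t\<bar>" by simp
qed

text \<open>
  The variance of an increment is only of order \<open>\<bar>s - t\<bar> powr \<gamma>\<close>, which is too weak for
  the criterion when \<open>\<gamma> \<le> 1\<close>; raising the order of the moment to \<open>2 * p\<close> raises the exponent to \<open>\<gamma> * p\<close>.
\<close>

lemma W_brownian_continuous_modification:
  assumes B: "W_brownian_motion M W B" and W: "mono W"
    and hoelder: "hoelder_on \<gamma> {a..<b} W" "0 < \<gamma>" and sub: "{a..<b} \<subseteq> {0..1}"
  shows "\<exists>Y. modification M {a..<b} B Y \<and> (\<forall>\<omega>\<in>space M. continuous_on {a..<b} (\<lambda>t. Y t \<omega>))"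
proof -
  obtain K where K: "0 \<le> K"
    "\<And>s t. s \<in> {a..<b} \<Longrightarrow> t \<in> {a..<b} \<Longrightarrow> \<bar>W s - W t\<bar> \<le> K * \<bar>s - t\<bar> powr \<gamma>"
    using hoelder(1) unfolding hoelder_on_def by blast
  obtain p :: nat where p: "1 < \<gamma> * p"
    using reals_Archimedean3[OF hoelder(2)] by (metis mult.commute)
  then have p0: "0 < p" by (cases p) auto
  define c :: real where "c = fact (2 * p) / (2 ^ p * fact p)"
  have c: "0 \<le> c" by (simp add: c_def)
  have even: "\<bar>x\<bar> powr (2 * p) = x ^ (2 * p)" for x :: real
  proof -
    have "\<bar>x\<bar> powr real (2 * p) = \<bar>x\<bar> ^ (2 * p)"
      using p0 by (intro powr_realpow') auto
    then show ?thesis by (simp add: power_even_abs)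
  qed
  have moment: "has_bochner_integral M (\<lambda>\<omega>. \<bar>B s \<omega> - B t \<omega>\<bar> powr (2 * p)) (c * \<bar>W s - W t\<bar> ^ p)"
    if "s \<in> {a..<b}" "t \<in> {a..<b}" for s t
  proof -
    have st: "s \<in> {0..1}" "t \<in> {0..1}" using that sub by auto
    note inc = W_brownian_increment[OF B W st]
    show ?thesis
      using centered_normal_even_moment[OF inc(1,2), of p] by (simp only: inc(3) even c_def)
  qed
  show ?thesis
  proof (rule kolmogorov_chentsov[where \<alpha> = "2 * p" and \<beta> = "\<gamma> * p - 1" and C = "c * K ^ p"])
    fix t assume "t \<in> {a..<b}"
    with sub have "t \<in> {0..1}" by blast
    then show "B t \<in> borel_measurable M" by (rule W_brownian_measurable[OF B])
  next
    fix s t assume st: "s \<in> {a..<b}" "t \<in> {a..<b}"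
    show "integrable M (\<lambda>\<omega>. \<bar>B s \<omega> - B t \<omega>\<bar> powr (2 * p))"
      using moment[OF st] by (simp add: has_bochner_integral_iff)
    have "expectation (\<lambda>\<omega>. \<bar>B s \<omega> - B t \<omega>\<bar> powr (2 * p)) = c * \<bar>W s - W t\<bar> ^ p"
      using moment[OF st] by (simp add: has_bochner_integral_iff)
    also have "\<dots> \<le> c * (K * \<bar>s - t\<bar> powr \<gamma>) ^ p"
      using K(2)[OF st] c by (intro mult_left_mono power_mono) auto
    also have "\<dots> = c * K ^ p * \<bar>s - t\<bar> powr (1 + (\<gamma> * p - 1))"
      using p0 by (cases "s = t") (auto simp: power_mult_distrib powr_power mult.commute)
    finally show "expectation (\<lambda>\<omega>. \<bar>B s \<omega> - B t \<omega>\<bar> powr (2 * p))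
      \<le> c * K ^ p * \<bar>s - t\<bar> powr (1 + (\<gamma> * p - 1))" .
  qed (use p p0 c K(1) in auto)
qed

end

section \<open>Gluing over the pieces\<close>

text \<open>
  Disjointness makes the piece containing \<open>t\<close> unique, hence the glued process agrees with
  \<open>Z i\<close> on the whole of \<open>P i\<close>. At times outside all pieces, such as the right end point of the
  time interval, the original process is kept.
\<close>

lemma modification_glue:
  assumes "disjoint_family_on P I"
    and "\<And>i. i \<in> I \<Longrightarrow> modification M (P i) X (Z i)"
    and "\<And>i \<omega>. i \<in> I \<Longrightarrow> \<omega> \<in> space M \<Longrightarrow> continuous_on (P i) (\<lambda>t. Z i t \<omega>)"
    and "\<And>t. t \<in> T \<Longrightarrow> X t \<in> borel_measurable M"
  shows "\<exists>Y. modification M T X Y \<and> (\<forall>\<omega>\<in>space M. \<forall>i\<in>I. continuous_on (P i) (\<lambda>t. Y t \<omega>))"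
proof -
  define Y where "Y t = (if \<exists>i\<in>I. t \<in> P i then Z (SOME i. i \<in> I \<and> t \<in> P i) t else X t)" for t
  have Y: "Y t = Z i t" if "i \<in> I" "t \<in> P i" for i t
  proof -
    have "(SOME j. j \<in> I \<and> t \<in> P j) = i"
      using that assms(1) by (intro some_equality) (auto simp: disjoint_family_on_def)
    then show ?thesis using that by (auto simp: Y_def)
  qed
  have "modification M T X Y"
    unfolding modification_def
  proof
    fix t assume t: "t \<in> T"
    show "Y t \<in> borel_measurable M \<and> (AE \<omega> in M. Y t \<omega> = X t \<omega>)"
    proof (cases "\<exists>i\<in>I. t \<in> P i")
      case True
      then show ?thesis using Y assms(2) by (auto simp: modification_def)
    next
      case False
      then show ?thesis using assms(4)[OF t] by (simp add: Y_def)
    qed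
  qed
  moreover have "continuous_on (P i) (\<lambda>t. Y t \<omega>)" if "\<omega> \<in> space M" "i \<in> I" for \<omega> i
    using assms(3)[OF that(2,1)] Y[OF that(2)] by (simp cong: continuous_on_cong)
  ultimately show ?thesis by blast
qed

lemma disjoint_pieces:
  assumes "strict_mono_on {1..N} d"
  shows "disjoint_family_on (piece N d) {1..N + 1}"
proof -
  have "piece N d i \<inter> piece N d j = {}" if "i \<in> {1..N + 1}" "j \<in> {1..N + 1}" "i < j" for i j
  proof -
    have "d i \<le> d (j - 1)"
      using strict_mono_on_leD[OF assms, of i "j - 1"] that by auto
    then show ?thesis using that by (auto simp: piece_def)
  qed
  then show ?thesis
    unfolding disjoint_family_on_def by (metis inf_commute linorder_neqE_nat)
qed


theorem proposition22:
  fixes M :: "'a measure" and W :: "real \<Rightarrow> real" and B :: "real \<Rightarrow> 'a \<Rightarrow> real"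
    and N :: nat and d :: "nat \<Rightarrow> real"
  assumes "prob_space M"
    and "strict_mono W" and "cadlag W"
    and "\<forall>x. W (x + 1) - W x = W 1 - W 0"
    and "isCont W 0" and "W 0 = 0"
    and "W_brownian_motion M W B"
    and "strict_mono_on {1..N} d"
    and "{x \<in> {0..<1}. \<not> isCont W x} = d ` {1..N}"
    and "\<forall>k\<in>{1..N+1}. \<exists>\<gamma>\<in>{0<..1}. hoelder_on \<gamma> (piece N d k) W"
  shows "\<exists>Y. modification M {0..1} B Y \<and>
           (\<forall>\<omega>\<in>space M. \<forall>k\<in>{1..N+1}. continuous_on (piece N d k) (\<lambda>t. Y t \<omega>))"
proof -
  interpret prob_space M by fact
  have d: "d i \<in> {0..<1}" if "i \<in> {1..N}" for i using assms(9) that by blast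
  have mono: "mono W" using assms(2) by (rule strict_mono_mono)
  have "\<exists>Z. modification M (piece N d k) B Z \<and>
      (\<forall>\<omega>\<in>space M. continuous_on (piece N d k) (\<lambda>t. Z t \<omega>))" if k: "k \<in> {1..N + 1}" for k
  proof -
    let ?a = "if k = 1 then 0 else d (k - 1)" and ?b = "if k = N + 1 then 1 else d k"
    have "0 \<le> ?a" "?b \<le> 1" using d[of "k - 1"] d[of k] k by (auto simp: Suc_le_eq)
    then have "{?a..<?b} \<subseteq> {0..1}" by auto
    moreover obtain \<gamma> where "0 < \<gamma>" "hoelder_on \<gamma> {?a..<?b} W"
      using assms(10) k unfolding piece_def by fastforce
    ultimately show ?thesis
      unfolding piece_def by (intro W_brownian_continuous_modification[OF assms(7) mono])
  qed
  then obtain Z where "\<And>k. k \<in> {1..N + 1} \<Longrightarrow> modification M (piece N d k) B (Z k)"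
    "\<And>k \<omega>. k \<in> {1..N + 1} \<Longrightarrow> \<omega> \<in> space M \<Longrightarrow> continuous_on (piece N d k) (\<lambda>t. Z k t \<omega>)"
    by metis
  then show ?thesis
    by (intro modification_glue[where Z = Z] disjoint_pieces assms(8)
        W_brownian_measurable[OF assms(7)])
qed

end
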